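(* For a simple graph $H$ let $W_{H}(t)$ denote its $Q$-generating function, regarded as a rational function of $t$. Let $G$ be a simple connected graph on $n$ vertices with complement $\overline{G}$, and let $G_1,G_2$ be simple connected graphs on $n_1,n_2$ vertices with $n=n_1+n_2$ in the last two formulas. Then \[ W_{\overline G } (t) = \frac{ - W_G \left( \frac{t}{(n - 2)t - 1} \right)}{(n - 2)t - 1 + tW_G \left( \frac{t}{(n - 2)t - 1} \right)}, \] \[ W_{G_1 \oplus G_2 } (t) = W_{G_1 } (t) + W_{G_2 } (t), \] \[ W_{G_1 \vee G_2 } (t) = \frac{M}{1 - tM},\qquad\text{where } M = \sum_{i = 1}^2 \frac{W_{G_i } (t)}{(n_i - n)t + 1 + tW_{G_i } (t)}. \]
   Context: For a simple graph $H$, $Q(H)=D(H)+A(H)$ is its signless Laplacian. A semi-edge walk of length $k$ in $H$ is an alternating sequence $v_{i_1},e_1,v_{i_2},\dots,e_k,v_{i_{k+1}}$ of vertices and edges such that for each $j$ the vertices $v_{i_j}$ and $v_{i_{j+1}}$ are end-vertices (not necessarily distinct) of $e_j$; $N_k$ is the number of such walks of length $k$, and the $Q$-generating function is $W_H(t)=\sum_{k\ge0}N_kt^k$ (equal to $\mathbf{1}^T(I-tQ(H))^{-1}\mathbf{1}$, a rational function of $t$). $G_1\oplus G_2$ is the disjoint union (direct sum) of $G_1$ and $G_2$; $G_1\vee G_2$ is the join, i.e. the disjoint union together with all edges between a vertex of $G_1$ and a vertex of $G_2$. (The paper writes $W_Q$, $W_{\overline Q}$, $W_{Q_1\oplus Q_2}$,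 $W_{Q_1\vee Q_2}$ for these generating functions.)
   Formalization: In the join formula, W_{G_i}(t) in M is replaced (both occurrences) by W_{G_i}(t/((n_i-n)t+1)); as printed the formula fails for K_2 joined with K_1, giving 3+12t+44t^2+... instead of W_{K_3}(t)=3/(1-4t)=3+12t+48t^2+.... *)

theory Defs
  imports
    Complex_Main
    "HOL-Computational_Algebra.Computational_Algebra"
    "HOL-Computational_Algebra.Field_as_Ring"
begin

record 'a graph =
  verts :: "'a set"
  edges :: "'a set set"

definition simple_graph :: "'a graph \<Rightarrow> bool" where
  "simple_graph H \<longleftrightarrow> finite (verts H) \<and> (\<forall>e\<in>edges H. e \<subseteq> verts H \<and> card e = 2)"

definition connected_graph :: "'a graph \<Rightarrow> bool" where
  "connected_graph H \<longleftrightarrow> verts H \<noteq> {} \<and>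
     (\<forall>u\<in>verts H. \<forall>v\<in>verts H. (u, v) \<in> {(x, y). {x, y} \<in> edges H}\<^sup>*)"

definition graph_complement :: "'a graph \<Rightarrow> 'a graph" where
  "graph_complement H =
     \<lparr>verts = verts H, edges = {e. e \<subseteq> verts H \<and> card e = 2 \<and> e \<notin> edges H}\<rparr>"

definition graph_direct_sum :: "'a graph \<Rightarrow> 'b graph \<Rightarrow> ('a + 'b) graph" where
  "graph_direct_sum G H =
     \<lparr>verts = verts G <+> verts H,
      edges = (\<lambda>e. Inl ` e) ` edges G \<union> (\<lambda>e. Inr ` e) ` edges H\<rparr>"

definition graph_join :: "'a graph \<Rightarrow> 'b graph \<Rightarrow> ('a + 'b) graph" where
  "graph_join G H =
     \<lparr>verts = verts (graph_direct_sum G H),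
      edges = edges (graph_direct_sum G H) \<union>
        {{Inl u, Inr v} | u v. u \<in> verts G \<and> v \<in> verts H}\<rparr>"

text \<open>A walk is given by the list of its \<open>k + 1\<close> vertices and the list of its \<open>k\<close> edges.
  Consecutive vertices may coincide, so the edge list is not determined by the vertex list.\<close>

definition semi_edge_walk :: "'a graph \<Rightarrow> nat \<Rightarrow> 'a list \<Rightarrow> 'a set list \<Rightarrow> bool" where
  "semi_edge_walk H k vs es \<longleftrightarrow>
     length vs = k + 1 \<and> length es = k \<and> set vs \<subseteq> verts H \<and> set es \<subseteq> edges H \<and>
     (\<forall>j<k. vs ! j \<in> es ! j \<and> vs ! (j + 1) \<in> es ! j)"

definition num_semi_edge_walks :: "'a graph \<Rightarrow> nat \<Rightarrow> nat" where
  "num_semi_edge_walks H k = card {(vs, es). semi_edge_walk H k vs es}"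

definition Q_gf_series :: "'a graph \<Rightarrow> real fps" where
  "Q_gf_series H = Abs_fps (\<lambda>k. of_nat (num_semi_edge_walks H k))"

text \<open>Rational functions in one indeterminate over a field \<open>'k\<close> are elements of the fraction
  field \<open>'k poly fract\<close>. A power series \<open>F\<close> represents the rational function \<open>p / q\<close>
  iff \<open>q F = p\<close> as power series; cross-multiplication shows that \<open>p / q\<close> is then unique.\<close>

definition represents_rat_fun :: "'k::field fps \<Rightarrow> 'k poly fract \<Rightarrow> bool" where
  "represents_rat_fun F r \<longleftrightarrow>
     (\<exists>p q. q \<noteq> 0 \<and> r = Fract p q \<and> fps_of_poly q * F = fps_of_poly p)"

definition rat_fun_of_fps :: "'k::field fps \<Rightarrow> 'k poly fract" where
  "rat_fun_of_fps F = (THE r. represents_rat_fun F r)"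

lemma represents_rat_fun_unique:
  assumes "represents_rat_fun F r" and "represents_rat_fun F s"
  shows "r = s"
proof -
  from assms obtain p q p' q' where
    1: "q \<noteq> 0" "r = Fract p q" "fps_of_poly q * F = fps_of_poly p" and
    2: "q' \<noteq> 0" "s = Fract p' q'" "fps_of_poly q' * F = fps_of_poly p'"
    unfolding represents_rat_fun_def by blast
  have "fps_of_poly (p * q') = fps_of_poly (p' * q)"
    unfolding fps_of_poly_mult 1(3)[symmetric] 2(3)[symmetric] by (simp add: mult_ac)
  then have "p * q' = p' * q"
    by simp
  with 1 2 show ?thesis
    by (simp add: eq_fract)
qed

lemma rat_fun_of_fps_eqI: "represents_rat_fun F r \<Longrightarrow> rat_fun_of_fps F = r"
  unfolding rat_fun_of_fps_def using represents_rat_fun_unique by blast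

text \<open>For a finite graph, the series has a denominator by the Cayley--Hamilton theorem applied
  to the signless Laplacian, so the description in \<open>rat_fun_of_fps\<close> is not void.\<close>

definition Q_gf :: "'a graph \<Rightarrow> real poly fract" where
  "Q_gf H = rat_fun_of_fps (Q_gf_series H)"

definition rat_fun_const :: "'k::field \<Rightarrow> 'k poly fract" where
  "rat_fun_const c = Fract [:c:] 1"

definition rat_fun_var :: "'k::field poly fract" where
  "rat_fun_var = Fract [:0, 1:] 1"

text \<open>Substitution \<open>f(g(t))\<close>, computed from the representation of \<open>f\<close> in lowest terms. It is
  meaningful unless \<open>g\<close> is a constant at which \<open>f\<close> has a pole.\<close>

definition rat_fun_compose ::
  "'k::field_gcd poly fract \<Rightarrow> 'k poly fract \<Rightarrow> 'k poly fract" where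
  "rat_fun_compose f g =
     (let (p, q) = quot_of_fract f
      in poly (map_poly rat_fun_const p) g / poly (map_poly rat_fun_const q) g)"

text \<open>In a join, every vertex of one part gains as many neighbours as the other part has
  vertices, which adds a multiple of the identity to the signless Laplacian of the part. So the
  join identity substitutes \<open>t / ((n\<^sub>i - n) t + 1)\<close> into the generating function of part \<open>i\<close>;
  with \<open>t\<close> in that place it fails, e.g. for the join of an edge and a vertex.\<close>

end

theory Submission
  imports Defs "Jordan_Normal_Form.Determinant"
begin

text \<open>The number of walks between two vertices is an entry of a power of the signless Laplacian
  \<open>Q\<close>, so \<open>W(t)\<close> is the sum of the entries of the solution \<open>x\<close> of \<open>(I - t Q) x = 1\<close>. The
  adjugate gives a solution with polynomial numerators and common denominator
  \<open>det (I - t Q)\<close>, which is \<open>1\<close> at \<open>t = 0\<close>; substituting \<open>s\<close> for \<open>t\<close> then solves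
  \<open>(I - s Q) x = 1\<close>. The signless Laplacian of the complement is \<open>(n - 2) I + J - Q\<close>, and
  that of the join has diagonal blocks \<open>Q\<^sub>i + (n - n\<^sub>i) I\<close> and all-ones off-diagonal blocks. In both
  cases multiples of the solutions for the given graphs, at the shifted argument, solve the new
  system. All denominators are nonzero because they are regular and equal to \<open>\<plusminus> 1\<close> at \<open>t = 0\<close>.\<close>

section \<open>Counting semi-edge walks\<close>

text \<open>This is the entry of \<open>Q = D + A\<close>: edges of a simple graph have two
  elements, so the count is the degree for \<open>u = v\<close> and the adjacency indicator
  otherwise. It also counts the ways a semi-edge walk can step from \<open>u\<close> to
  \<open>v\<close>.\<close>

definition qentry :: "'a graph \<Rightarrow> 'a \<Rightarrow> 'a \<Rightarrow> nat" where
  "qentry H u v = card {e \<in> edges H. u \<in> e \<and> v \<in> e}"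

definition walks_from :: "'a graph \<Rightarrow> nat \<Rightarrow> 'a \<Rightarrow> ('a list \<times> 'a set list) set" where
  "walks_from H k u = {(vs, es). semi_edge_walk H k vs es \<and> vs ! 0 = u}"

lemma qentry_commute: "qentry H u v = qentry H v u"
  unfolding qentry_def by (rule arg_cong[of _ _ card]) auto

lemma simple_graph_finite_edges: "simple_graph H \<Longrightarrow> finite (edges H)"
  unfolding simple_graph_def by (rule finite_subset[of _ "Pow (verts H)"]) auto

lemma semi_edge_walk_Suc:
  "semi_edge_walk H (Suc k) (u # vs) (e # es) \<longleftrightarrow>
     u \<in> verts H \<and> e \<in> edges H \<and> u \<in> e \<and> vs ! 0 \<in> e \<and> semi_edge_walk H k vs es"
  unfolding semi_edge_walk_def by (auto simp: All_less_Suc2)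

lemma walks_from_0: "u \<in> verts H \<Longrightarrow> walks_from H 0 u = {([u], [])}"
  unfolding walks_from_def semi_edge_walk_def by (auto simp: length_Suc_conv)

text \<open>A longer walk from \<open>u\<close> is a first edge through \<open>u\<close>, a vertex
  \<open>v\<close> on that edge, and a walk from \<open>v\<close>.\<close>

lemma walks_from_Suc:
  assumes "u \<in> verts H"
  shows "walks_from H (Suc k) u =
    (\<Union>v\<in>verts H. (\<lambda>(e, vs, es). (u # vs, e # es)) `
      ({e \<in> edges H. u \<in> e \<and> v \<in> e} \<times> walks_from H k v))"
proof (intro equalityI subsetI)
  fix w assume "w \<in> walks_from H (Suc k) u"
  then obtain vs es where w: "w = (vs, es)" "semi_edge_walk H (Suc k) vs es" "vs ! 0 = u"
    by (auto simp: walks_from_def)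
  obtain vs' where vs: "vs = u # vs'"
    using w by (cases vs) (auto simp: semi_edge_walk_def)
  obtain e es' where es: "es = e # es'"
    using w by (cases es) (auto simp: semi_edge_walk_def)
  have *: "e \<in> edges H" "u \<in> e" "vs' ! 0 \<in> e" "semi_edge_walk H k vs' es'"
    using w(2) unfolding vs es semi_edge_walk_Suc by auto
  moreover have "vs' ! 0 \<in> verts H"
    using *(4) by (cases vs') (auto simp: semi_edge_walk_def)
  ultimately show "w \<in> (\<Union>v\<in>verts H. (\<lambda>(e, vs, es). (u # vs, e # es)) `
      ({e \<in> edges H. u \<in> e \<and> v \<in> e} \<times> walks_from H k v))"
    unfolding w(1) vs es walks_from_def by force
qed (use assms in \<open>auto simp: walks_from_def semi_edge_walk_Suc\<close>)

lemma finite_walks: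
  assumes "simple_graph H"
  shows "finite {(vs, es). semi_edge_walk H k vs es}"
proof (rule finite_subset)
  show "{(vs, es). semi_edge_walk H k vs es} \<subseteq>
      {vs. set vs \<subseteq> verts H \<and> length vs = k + 1} \<times> {es. set es \<subseteq> edges H \<and> length es = k}"
    by (auto simp: semi_edge_walk_def)
  show "finite ({vs. set vs \<subseteq> verts H \<and> length vs = k + 1} \<times>
      {es. set es \<subseteq> edges H \<and> length es = k})"
    using assms simple_graph_finite_edges[OF assms]
    by (intro finite_cartesian_product finite_lists_length_eq) (auto simp: simple_graph_def)
qed

lemma finite_walks_from: "simple_graph H \<Longrightarrow> finite (walks_from H k u)"
  by (rule finite_subset[OF _ finite_walks[of H k]]) (auto simp: walks_from_def)

text \<open>The second vertex of a walk determines \<open>v\<close> in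
  \<open>walks_from_Suc\<close>, so that union is disjoint and the vectors of walk counts satisfy
  \<open>N (k + 1) = Q (N k)\<close>.\<close>

lemma card_walks_from_Suc:
  assumes H: "simple_graph H" and u: "u \<in> verts H"
  shows "card (walks_from H (Suc k) u) = (\<Sum>v\<in>verts H. qentry H u v * card (walks_from H k v))"
proof -
  have fin: "finite (verts H)" "finite (edges H)"
    using H simple_graph_finite_edges[OF H] by (auto simp: simple_graph_def)
  have inj: "inj_on (\<lambda>(e, vs, es). (u # vs, e # es)) A" for A :: "('a set \<times> 'a list \<times> 'a set list) set"
    by (auto simp: inj_on_def)
  show ?thesis
    unfolding walks_from_Suc[OF u]
    \<comment> \<open>The first pass keeps \<open>walks_from\<close> folded so that the finiteness
      and product rules apply; only disjointness needs its definition.\<close>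
    by (subst card_UN_disjoint)
      (auto simp: fin finite_walks_from[OF H] card_image[OF inj] card_cartesian_product qentry_def,
       auto simp: walks_from_def)
qed

lemma num_semi_edge_walks_eq_sum:
  assumes H: "simple_graph H"
  shows "num_semi_edge_walks H k = (\<Sum>u\<in>verts H. card (walks_from H k u))"
proof -
  have fin: "finite (verts H)"
    using H by (auto simp: simple_graph_def)
  have "vs ! 0 \<in> verts H" if "semi_edge_walk H k vs es" for vs :: "'a list" and es
    using that by (cases vs) (auto simp: semi_edge_walk_def)
  then have walks: "{(vs, es). semi_edge_walk H k vs es} = (\<Union>u\<in>verts H. walks_from H k u)"
    by (auto simp: walks_from_def)
  show ?thesis
    unfolding num_semi_edge_walks_def walks
    by (subst card_UN_disjoint)
      (auto simp: fin finite_walks_from[OF H], auto simp: walks_from_def)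
qed

section \<open>Linear systems with matrix \<open>I - s Q\<close>\<close>

text \<open>The system \<open>(I - s Q) x = c 1\<close>. A general commutative ring and constant
  \<open>c\<close> admit polynomial solutions, with \<open>c\<close> a common denominator, besides
  rational ones with \<open>c = 1\<close>.\<close>

definition Q_system :: "'a graph \<Rightarrow> 'k::comm_ring_1 \<Rightarrow> 'k \<Rightarrow> ('a \<Rightarrow> 'k) \<Rightarrow> bool" where
  "Q_system H s c x \<longleftrightarrow>
     (\<forall>u\<in>verts H. x u - s * (\<Sum>v\<in>verts H. of_nat (qentry H u v) * x v) = c)"

lemma Q_systemD:
  "Q_system H s c x \<Longrightarrow> u \<in> verts H \<Longrightarrow>
     x u - s * (\<Sum>v\<in>verts H. of_nat (qentry H u v) * x v) = c"
  by (simp add: Q_system_def)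

text \<open>Both sides are \<open>y\<^sup>T (I - s Q) x\<close>, because \<open>Q\<close> is symmetric.\<close>

lemma Q_system_sums:
  assumes x: "Q_system H s c x" and y: "Q_system H s d y"
  shows "c * (\<Sum>u\<in>verts H. y u) = d * (\<Sum>u\<in>verts H. x u)"
proof -
  let ?V = "verts H" and ?Q = "\<lambda>u v. of_nat (qentry H u v)"
  have "c * sum y ?V = (\<Sum>u\<in>?V. y u * (x u - s * (\<Sum>v\<in>?V. ?Q u v * x v)))"
    using x by (simp add: Q_system_def sum_distrib_left mult.commute)
  also have "\<dots> = (\<Sum>u\<in>?V. y u * x u) - s * (\<Sum>u\<in>?V. \<Sum>v\<in>?V. y u * (?Q u v * x v))"
    by (simp add: right_diff_distrib sum_subtractf sum_distrib_left mult_ac)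
  also have "(\<Sum>u\<in>?V. \<Sum>v\<in>?V. y u * (?Q u v * x v)) = (\<Sum>u\<in>?V. \<Sum>v\<in>?V. x u * (?Q u v * y v))"
    by (subst sum.swap) (simp add: qentry_commute mult_ac)
  also have "(\<Sum>u\<in>?V. y u * x u) - s * \<dots> = (\<Sum>u\<in>?V. x u * (y u - s * (\<Sum>v\<in>?V. ?Q u v * y v)))"
    by (simp add: right_diff_distrib sum_subtractf sum_distrib_left mult_ac)
  also have "\<dots> = d * sum x ?V"
    using y by (simp add: Q_system_def sum_distrib_left mult.commute)
  finally show ?thesis .
qed

text \<open>Used to move polynomial solutions into the fraction field, both along the embedding
  \<open>to_fract\<close> and along substitution of a rational function for the variable.\<close>

lemma Q_system_hom:
  assumes "Q_system H s c x"
    and add: "\<And>a b. h (a + b) = h a + h b" and mult: "\<And>a b. h (a * b) = h a * h b"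
    and one: "h 1 = 1"
  shows "Q_system H (h s) (h c) (\<lambda>u. h (x u))"
proof -
  have zero: "h 0 = 0"
    using add[of 0 0] by simp
  have diff: "h (a - b) = h a - h b" for a b
    using add[of "a - b" b] by simp
  have nat: "h (of_nat k) = of_nat k" for k
    by (induction k) (simp_all add: zero one add)
  have sum: "h (sum f A) = (\<Sum>a\<in>A. h (f a))" for f and A :: "'a set"
    by (induction A rule: infinite_finite_induct) (simp_all add: zero add)
  show ?thesis
    unfolding Q_system_def
    using Q_systemD[OF assms(1), THEN arg_cong[of _ _ h]]
    by (simp add: diff mult sum nat)
qed

text \<open>For \<open>P = I - t A\<close> the identity \<open>P * adj P = det P * I\<close> shows
  that the row sums of the adjugate solve the system with right-hand side
  \<open>det P\<close>.\<close>

lemma linear_system_poly_exists: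
  fixes A :: "'a \<Rightarrow> 'a \<Rightarrow> 'k::field poly"
  assumes "finite V"
  shows "\<exists>x q. poly q 0 = 1 \<and> (\<forall>u\<in>V. x u - [:0, 1:] * (\<Sum>v\<in>V. A u v * x v) = q)"
proof -
  define n where "n = card V"
  obtain g where g: "bij_betw g {0..<n} V"
    using ex_bij_betw_nat_finite[OF assms] n_def by blast
  define f where "f = inv_into {0..<n} g"
  define P where "P = mat n n (\<lambda>(i, j). (if i = j then 1 else 0) - [:0, 1:] * A (g i) (g j))"
  define y where "y = (\<lambda>i. \<Sum>k<n. adj_mat P $$ (i, k))"
  have P: "P \<in> carrier_mat n n"
    by (simp add: P_def)
  have f: "f u < n" "g (f u) = u" if "u \<in> V" for u
    using g that bij_betw_inv_into_right[OF g that] bij_betw_imp_surj_on[OF g]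
      inv_into_into[of u g "{0..<n}"]
    unfolding f_def by auto
  have sys: "(\<Sum>j<n. P $$ (i, j) * y j) = det P" if i: "i < n" for i
  proof -
    have "(\<Sum>j<n. P $$ (i, j) * y j) = (\<Sum>k<n. \<Sum>j<n. P $$ (i, j) * adj_mat P $$ (j, k))"
      unfolding y_def sum_distrib_left by (rule sum.swap)
    also have "\<dots> = (\<Sum>k<n. (P * adj_mat P) $$ (i, k))"
      using i P adj_mat(1)[OF P]
      by (intro sum.cong refl) (auto simp: scalar_prod_def atLeast0LessThan intro!: sum.cong)
    also have "\<dots> = (\<Sum>k<n. if k = i then det P else 0)"
      unfolding adj_mat(2)[OF P] using i by (intro sum.cong refl) auto
    finally show ?thesis
      using i by simp
  qed
  \<comment> \<open>Evaluation at 0 commutes with determinants and sends \<open>P\<close> to the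
    identity matrix, whence \<open>det P\<close> takes the value 1 there.\<close>
  interpret ev: comm_ring_hom "\<lambda>p :: 'k poly. poly p 0"
    by unfold_locales auto
  have "map_mat (\<lambda>p. poly p 0) P = 1\<^sub>m n"
    by (rule eq_matI) (auto simp: P_def)
  then have "poly (det P) 0 = 1"
    using ev.hom_det[of P] by simp
  moreover have "y (f u) - [:0, 1:] * (\<Sum>v\<in>V. A u v * y (f v)) = det P" if u: "u \<in> V" for u
  proof -
    have "(\<Sum>v\<in>V. A u v * y (f v)) = (\<Sum>j<n. A u (g j) * y j)"
      using bij_betw_inv_into_left[OF g]
      by (subst sum.reindex_bij_betw[OF g, symmetric])
         (auto simp: f_def atLeast0LessThan intro!: sum.cong)
    moreover have "(\<Sum>j<n. P $$ (f u, j) * y j) =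
        (\<Sum>j<n. (if f u = j then y j else 0) - [:0, 1:] * (A u (g j) * y j))"
      using f[OF u] by (intro sum.cong refl) (auto simp: P_def algebra_simps)
    ultimately show ?thesis
      using sys[of "f u"] f[OF u] by (simp add: sum_subtractf sum_distrib_left)
  qed
  ultimately show ?thesis
    by (intro exI[of _ "y \<circ> f"] exI[of _ "det P"]) auto
qed

lemma Q_system_poly_exists:
  assumes "finite (verts H)"
  obtains x and q :: "'k::field poly" where "poly q 0 = 1" "Q_system H [:0, 1:] q x"
  using linear_system_poly_exists[OF assms, of "\<lambda>u v. of_nat (qentry H u v)"]
  unfolding Q_system_def by blast

text \<open>The walk series \<open>F u\<close> solve the system with right-hand side 1. Hence the
  defects \<open>q F u - p u\<close> solve the homogeneous system \<open>D = t Q D\<close>, whose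
  factor \<open>t\<close> forces \<open>D = 0\<close>.\<close>

lemma Q_gf_eq_Fract:
  assumes H: "simple_graph H" and q: "q \<noteq> 0" and p: "Q_system H [:0, 1:] q p"
  shows "Q_gf H = Fract (\<Sum>u\<in>verts H. p u) q"
proof -
  let ?V = "verts H"
  define F :: "'a \<Rightarrow> real fps" where "F u = Abs_fps (\<lambda>k. of_nat (card (walks_from H k u)))" for u
  define D where "D u = fps_of_poly q * F u - fps_of_poly (p u)" for u
  \<comment> \<open>The constant coefficient 1 is the walk of length 0; the others are the recursion
    for walk counts.\<close>
  have F: "F u = 1 + fps_X * (\<Sum>v\<in>?V. of_nat (qentry H u v) * F v)" if u: "u \<in> ?V" for u
  proof (rule fps_ext)
    fix k show "F u $ k = (1 + fps_X * (\<Sum>v\<in>?V. of_nat (qentry H u v) * F v)) $ k"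
      using u by (cases k) 
        (simp_all add: F_def walks_from_0 card_walks_from_Suc[OF H] fps_sum_nth fps_of_nat[symmetric])
  qed
  have p': "fps_of_poly (p u) =
      fps_of_poly q + fps_X * (\<Sum>v\<in>?V. of_nat (qentry H u v) * fps_of_poly (p v))"
    if "u \<in> ?V" for u
  proof -
    have nat: "fps_of_poly (of_nat m) = (of_nat m :: real fps)" for m
      by (induction m) (simp_all add: fps_of_poly_add)
    have "p u = q + [:0, 1:] * (\<Sum>v\<in>?V. of_nat (qentry H u v) * p v)"
      using Q_systemD[OF p that] by (simp add: algebra_simps)
    from arg_cong[OF this, of fps_of_poly] show ?thesis
      by (simp only: fps_of_poly_add fps_of_poly_mult fps_of_poly_sum nat fps_of_poly_fps_X)
  qed
  have D: "D u = fps_X * (\<Sum>v\<in>?V. of_nat (qentry H u v) * D v)" if "u \<in> ?V" for u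
  proof -
    have "D u = fps_X * (fps_of_poly q * (\<Sum>v\<in>?V. of_nat (qentry H u v) * F v) -
        (\<Sum>v\<in>?V. of_nat (qentry H u v) * fps_of_poly (p v)))"
      unfolding D_def by (subst F[OF that], subst p'[OF that]) (simp add: algebra_simps)
    also have "\<dots> = fps_X * (\<Sum>v\<in>?V. of_nat (qentry H u v) * D v)"
      by (simp add: D_def right_diff_distrib sum_subtractf sum_distrib_left mult_ac)
    finally show ?thesis .
  qed
  \<comment> \<open>Multiplication by \<open>fps_X\<close> shifts indices: the constant coefficient
    vanishes, and coefficient \<open>k + 1\<close> is a combination of coefficients
    \<open>k\<close>.\<close>
  have "D u $ k = 0" if "u \<in> ?V" for u k
    using that
  proof (induction k arbitrary: u)
    case (Suc k)
    then show ?case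
      by (subst D) (simp_all add: fps_sum_nth fps_of_nat[symmetric])
  qed (subst D, simp_all)
  then have "D u = 0" if "u \<in> ?V" for u
    using that by (simp add: fps_eq_iff)
  then have "(\<Sum>u\<in>?V. fps_of_poly q * F u) = (\<Sum>u\<in>?V. fps_of_poly (p u))"
    by (intro sum.cong refl) (simp add: D_def)
  moreover have "Q_gf_series H = (\<Sum>u\<in>?V. F u)"
    by (rule fps_ext) (simp add: Q_gf_series_def num_semi_edge_walks_eq_sum[OF H] F_def fps_sum_nth)
  ultimately have "fps_of_poly q * Q_gf_series H = fps_of_poly (\<Sum>u\<in>?V. p u)"
    by (simp add: sum_distrib_left fps_of_poly_sum)
  with q show ?thesis
    unfolding Q_gf_def by (intro rat_fun_of_fps_eqI) (auto simp: represents_rat_fun_def)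
qed

text \<open>By \<open>Q_system_sums\<close>, a rational solution and the polynomial solution have
  proportional entry sums. So each identity reduces to exhibiting one solution for the new
  graph.\<close>

lemma Q_gf_eqI:
  assumes H: "simple_graph H" and x: "Q_system H rat_fun_var 1 x"
  shows "Q_gf H = (\<Sum>u\<in>verts H. x u)"
proof -
  have "finite (verts H)"
    using H by (simp add: simple_graph_def)
  then obtain p and q :: "real poly" where q: "poly q 0 = 1" and p: "Q_system H [:0, 1:] q p"
    by (rule Q_system_poly_exists)
  have q0: "q \<noteq> 0"
    using q by auto
  have "Q_system H (to_fract [:0, 1:]) (to_fract q) (\<lambda>u. to_fract (p u))"
    using p by (rule Q_system_hom) simp_all
  then have "Q_system H rat_fun_var (to_fract q) (\<lambda>u. to_fract (p u))"
    by (simp add: rat_fun_var_def to_fract_def)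
  from Q_system_sums[OF this x]
  have "to_fract q * (\<Sum>u\<in>verts H. x u) = to_fract (\<Sum>u\<in>verts H. p u)"
    by (simp add: to_fract_sum)
  with q0 show ?thesis
    unfolding Q_gf_eq_Fract[OF H q0 p] Fract_conv_to_fract by (simp add: field_simps)
qed

section \<open>Rational functions without a pole at the origin\<close>

text \<open>Regularity at the origin and the value there form one relation, so that the closure
  rules compute the value while proving regularity.\<close>

definition value_at_0 :: "'k::field poly fract \<Rightarrow> 'k \<Rightarrow> bool" where
  "value_at_0 f a \<longleftrightarrow> (\<exists>p q. poly q 0 \<noteq> 0 \<and> f = Fract p q \<and> a = poly p 0 / poly q 0)"

lemma value_at_0I:
  "poly q 0 \<noteq> 0 \<Longrightarrow> f = Fract p q \<Longrightarrow> a = poly p 0 / poly q 0 \<Longrightarrow> value_at_0 f a"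
  unfolding value_at_0_def by blast

text \<open>This is how the denominators of the identities are shown to be nonzero.\<close>

lemma value_at_0_nonzero:
  assumes "value_at_0 f a" and "a \<noteq> 0"
  shows "f \<noteq> 0"
proof
  assume "f = 0"
  then obtain p q where *: "poly q 0 \<noteq> 0" "Fract p q = 0" "a = poly p 0 / poly q 0"
    using assms(1) by (auto simp: value_at_0_def)
  then have "q \<noteq> 0" by auto
  with * have "p = 0"
    by (simp add: Zero_fract_def eq_fract)
  with * assms(2) show False by simp
qed

lemma value_at_0_const [intro]: "value_at_0 (rat_fun_const a) a"
  by (rule value_at_0I[of 1 _ "[:a:]"]) (simp_all add: rat_fun_const_def)

lemma value_at_0_0 [intro]: "value_at_0 0 0"
  by (rule value_at_0I[of 1 _ 0]) (simp_all add: Zero_fract_def)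

lemma value_at_0_1 [intro]: "value_at_0 1 1"
  by (rule value_at_0I[of 1 _ 1]) (simp_all add: One_fract_def)

lemma value_at_0_of_nat [intro]: "value_at_0 (of_nat k) (of_nat k)"
  by (rule value_at_0I[of 1 _ "of_nat k"]) (simp_all add: of_nat_fract)

lemma value_at_0_var [intro]: "value_at_0 rat_fun_var 0"
  by (rule value_at_0I[of 1 _ "[:0, 1:]"]) (simp_all add: rat_fun_var_def)

lemma value_at_0_add [intro]:
  assumes "value_at_0 f a" "value_at_0 g b"
  shows "value_at_0 (f + g) (a + b)"
proof -
  obtain p q p' q' where *: "poly q 0 \<noteq> 0" "f = Fract p q" "a = poly p 0 / poly q 0"
    "poly q' 0 \<noteq> 0" "g = Fract p' q'" "b = poly p' 0 / poly q' 0"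
    using assms by (auto simp: value_at_0_def)
  then have "q \<noteq> 0" "q' \<noteq> 0" by auto
  with * show ?thesis
    by (intro value_at_0I[of "q * q'" _ "p * q' + p' * q"]) (simp_all add: add_frac_eq)
qed

lemma value_at_0_mult [intro]:
  assumes "value_at_0 f a" "value_at_0 g b"
  shows "value_at_0 (f * g) (a * b)"
proof -
  obtain p q p' q' where *: "poly q 0 \<noteq> 0" "f = Fract p q" "a = poly p 0 / poly q 0"
    "poly q' 0 \<noteq> 0" "g = Fract p' q'" "b = poly p' 0 / poly q' 0"
    using assms by (auto simp: value_at_0_def)
  then show ?thesis
    by (intro value_at_0I[of "q * q'" _ "p * p'"]) auto
qed

lemma value_at_0_inverse:
  assumes "value_at_0 f a" "a \<noteq> 0"
  shows "value_at_0 (inverse f) (inverse a)"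
proof -
  obtain p q where *: "poly q 0 \<noteq> 0" "f = Fract p q" "a = poly p 0 / poly q 0"
    using assms by (auto simp: value_at_0_def)
  with assms(2) show ?thesis
    by (intro value_at_0I[of p _ q]) auto
qed

lemma value_at_0_divide [intro]:
  "value_at_0 f a \<Longrightarrow> value_at_0 g b \<Longrightarrow> b \<noteq> 0 \<Longrightarrow> value_at_0 (f / g) (a / b)"
  unfolding divide_inverse by (intro value_at_0_mult value_at_0_inverse)

lemma value_at_0_uminus [intro]: "value_at_0 f a \<Longrightarrow> value_at_0 (- f) (- a)"
  unfolding value_at_0_def by (metis minus_fract poly_minus minus_divide_left)

lemma value_at_0_diff [intro]:
  "value_at_0 f a \<Longrightarrow> value_at_0 g b \<Longrightarrow> value_at_0 (f - g) (a - b)"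
  using value_at_0_add[of f a "- g" "- b"] by auto

lemma value_at_0_sum:
  "(\<And>i. i \<in> A \<Longrightarrow> value_at_0 (f i) (a i)) \<Longrightarrow> value_at_0 (\<Sum>i\<in>A. f i) (\<Sum>i\<in>A. a i)"
  by (induction A rule: infinite_finite_induct) auto

section \<open>Substitution into polynomials and rational functions\<close>

text \<open>The evaluation homomorphism at \<open>s\<close>, in the form in which
  \<open>rat_fun_compose\<close> applies it to numerator and denominator.\<close>

definition poly_subst :: "'k::field poly fract \<Rightarrow> 'k poly \<Rightarrow> 'k poly fract" where
  "poly_subst s p = poly (map_poly rat_fun_const p) s"

lemma rat_fun_const_0 [simp]: "rat_fun_const 0 = 0"
  by (simp add: rat_fun_const_def Zero_fract_def)

lemma rat_fun_const_1 [simp]: "rat_fun_const 1 = 1"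
  by (simp add: rat_fun_const_def One_fract_def pCons_one)

lemma rat_fun_const_add: "rat_fun_const (a + b) = rat_fun_const a + rat_fun_const b"
  by (simp add: rat_fun_const_def)

lemma rat_fun_const_mult: "rat_fun_const (a * b) = rat_fun_const a * rat_fun_const b"
  by (simp add: rat_fun_const_def mult.commute)

lemma poly_subst_pCons [simp]: "poly_subst s (pCons a p) = rat_fun_const a + s * poly_subst s p"
  by (simp add: poly_subst_def map_poly_pCons)

lemma poly_subst_0 [simp]: "poly_subst s 0 = 0"
  by (simp add: poly_subst_def)

lemma poly_subst_1 [simp]: "poly_subst s 1 = 1"
  by (simp add: poly_subst_def)

lemma poly_subst_add: "poly_subst s (p + q) = poly_subst s p + poly_subst s q"
  by (induction p q rule: poly_induct2) (simp_all add: rat_fun_const_add algebra_simps)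

lemma poly_subst_smult: "poly_subst s (Polynomial.smult a p) = rat_fun_const a * poly_subst s p"
  by (induction p) (simp_all add: rat_fun_const_mult algebra_simps)

lemma poly_subst_mult: "poly_subst s (p * q) = poly_subst s p * poly_subst s q"
  by (induction p) (simp_all add: poly_subst_add poly_subst_smult algebra_simps)

lemma poly_subst_sum: "poly_subst s (\<Sum>i\<in>A. f i) = (\<Sum>i\<in>A. poly_subst s (f i))"
  by (induction A rule: infinite_finite_induct) (simp_all add: poly_subst_add)

text \<open>Since \<open>s\<close> vanishes at the origin, only the constant coefficient of
  \<open>p\<close> survives there. In particular a denominator with value 1 at 0 stays nonzero after
  substitution.\<close>

lemma value_at_0_poly_subst:
  assumes "value_at_0 s 0"
  shows "value_at_0 (poly_subst s p) (poly p 0)"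
proof (induction p)
  case (pCons a p)
  have "value_at_0 (rat_fun_const a + s * poly_subst s p) (a + 0 * poly p 0)"
    by (intro value_at_0_add value_at_0_mult value_at_0_const assms pCons.IH)
  then show ?case by simp
qed auto

text \<open>Any representation whose denominator does not vanish at the substituted point may replace
  the one in lowest terms, since the reduced denominator divides it.\<close>

lemma rat_fun_compose_Fract:
  assumes q: "poly_subst s q \<noteq> 0"
  shows "rat_fun_compose (Fract p q) s = poly_subst s p / poly_subst s q"
proof -
  obtain p' q' where pq: "quot_of_fract (Fract p q) = (p', q')"
    by fastforce
  have q0: "q \<noteq> 0"
    using q by auto
  have q'0: "q' \<noteq> 0" and cop: "coprime p' q'" and eq: "Fract p' q' = Fract p q"
    using snd_quot_of_fract_nonzero[of "Fract p q"] coprime_quot_of_fract[of "Fract p q"]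
      Fract_quot_of_fract[of "Fract p q"]
    by (simp_all add: pq)
  have cross: "p' * q = p * q'"
    using eq q0 q'0 by (simp add: eq_fract)
  then have "q' dvd p' * q"
    by simp
  then have "q' dvd q"
    using cop by (simp add: coprime_commute coprime_dvd_mult_right_iff)
  then obtain r where r: "q = q' * r"
    by blast
  have p: "p = p' * r"
    using cross q'0 unfolding r by (metis mult.assoc mult.commute mult_cancel_right)
  have "rat_fun_compose (Fract p q) s = poly_subst s p' / poly_subst s q'"
    by (simp add: rat_fun_compose_def pq poly_subst_def)
  also have "\<dots> = poly_subst s p / poly_subst s q"
    using q by (simp add: p r poly_subst_mult)
  finally show ?thesis .
qed

text \<open>Substituting \<open>s\<close> into the polynomial solution and dividing by the
  substituted denominator, which has value 1 at the origin, gives a solution at \<open>s\<close>.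
  Regularity of the entry sum is recorded because later denominators contain its product with
  \<open>t\<close>.\<close>

lemma Q_system_compose:
  assumes H: "simple_graph H" and s: "value_at_0 s 0"
  obtains x a where "Q_system H s 1 x"
    and "(\<Sum>u\<in>verts H. x u) = rat_fun_compose (Q_gf H) s"
    and "value_at_0 (rat_fun_compose (Q_gf H) s) a"
proof -
  have "finite (verts H)"
    using H by (simp add: simple_graph_def)
  then obtain p and q :: "real poly" where q: "poly q 0 = 1" and p: "Q_system H [:0, 1:] q p"
    by (rule Q_system_poly_exists)
  have q0: "q \<noteq> 0"
    using q by auto
  have vq: "value_at_0 (poly_subst s q) 1"
    using value_at_0_poly_subst[OF s, of q] q by simp
  then have sq: "poly_subst s q \<noteq> 0"
    by (rule value_at_0_nonzero) simp
  define x where "x u = poly_subst s (p u) / poly_subst s q" for u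
  have "Q_system H (poly_subst s [:0, 1:]) (poly_subst s q) (\<lambda>u. poly_subst s (p u))"
    using p by (rule Q_system_hom) (simp_all add: poly_subst_add poly_subst_mult)
  then have sys: "poly_subst s (p u) - s * (\<Sum>v\<in>verts H. of_nat (qentry H u v) * poly_subst s (p v))
      = poly_subst s q" if "u \<in> verts H" for u
    using that by (simp add: Q_system_def)
  have "Q_system H s 1 x"
    unfolding Q_system_def x_def
    using sys sq by (simp add: sum_divide_distrib[symmetric] diff_divide_distrib[symmetric])
  moreover have W: "rat_fun_compose (Q_gf H) s = (\<Sum>u\<in>verts H. x u)"
    unfolding Q_gf_eq_Fract[OF H q0 p] rat_fun_compose_Fract[OF sq]
    by (simp add: poly_subst_sum x_def sum_divide_distrib)
  moreover have "value_at_0 (rat_fun_compose (Q_gf H) s) (\<Sum>u\<in>verts H. poly (p u) 0 / 1)"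
    unfolding W x_def
    by (intro value_at_0_sum value_at_0_divide value_at_0_poly_subst s vq) simp
  ultimately show ?thesis
    using that by metis
qed

section \<open>Complement, direct sum and join\<close>

text \<open>These are the entries of the signless Laplacian \<open>(n - 2) I + J\<close> of the
  complete graph on \<open>V\<close>.\<close>

lemma card_pairs_containing:
  assumes V: "finite V" and u: "u \<in> V" and v: "v \<in> V"
  shows "card {e. e \<subseteq> V \<and> card e = 2 \<and> u \<in> e \<and> v \<in> e} = (if u = v then card V - 1 else 1)"
proof (cases "u = v")
  case True
  have "{e. e \<subseteq> V \<and> card e = 2 \<and> u \<in> e \<and> v \<in> e} = (\<lambda>w. {u, w}) ` (V - {u})"
    using u True by (auto simp: card_2_iff)
  moreover have "inj_on (\<lambda>w. {u, w}) (V - {u})"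
    by (auto simp: inj_on_def doubleton_eq_iff)
  ultimately show ?thesis
    using True u V by (simp add: card_image)
next
  case False
  have "{e. e \<subseteq> V \<and> card e = 2 \<and> u \<in> e \<and> v \<in> e} = {{u, v}}"
    using u v False by (auto simp: card_2_iff)
  then show ?thesis
    using False by simp
qed

section \<open>Signless Laplacian of the complement\<close>

lemma simple_graph_complement: "simple_graph H \<Longrightarrow> simple_graph (graph_complement H)"
  by (auto simp: simple_graph_def graph_complement_def)

text \<open>A graph and its complement partition the edges of the complete graph. The additive form
  avoids truncated subtraction.\<close>

lemma qentry_complement:
  assumes H: "simple_graph H" and uv: "u \<in> verts H" "v \<in> verts H"
  shows "qentry (graph_complement H) u v + qentry H u v =
    (if u = v then card (verts H) - 1 else 1)"
proof -
  let ?A = "{e. e \<subseteq> verts H \<and> card e = 2 \<and> u \<in> e \<and> v \<in> e}"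
  have fin: "finite (verts H)"
    using H by (simp add: simple_graph_def)
  have "finite ?A"
    by (rule finite_subset[of _ "Pow (verts H)"]) (auto simp: fin)
  moreover have "{e \<in> edges H. u \<in> e \<and> v \<in> e} \<subseteq> ?A"
    using H by (auto simp: simple_graph_def)
  moreover have "{e \<in> edges (graph_complement H). u \<in> e \<and> v \<in> e} =
      ?A - {e \<in> edges H. u \<in> e \<and> v \<in> e}"
    by (auto simp: graph_complement_def)
  ultimately have "qentry (graph_complement H) u v + qentry H u v = card ?A"
    unfolding qentry_def by (simp add: card_Diff_subset finite_subset card_mono)
  then show ?thesis
    using card_pairs_containing[OF fin uv] by simp
qed

lemma sum_qentry_complement:
  fixes x :: "'a \<Rightarrow> 'k::comm_ring_1"
  assumes H: "simple_graph H" and u: "u \<in> verts H"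
  shows "(\<Sum>v\<in>verts H. of_nat (qentry (graph_complement H) u v) * x v) =
    (of_nat (card (verts H)) - 2) * x u + (\<Sum>v\<in>verts H. x v)
      - (\<Sum>v\<in>verts H. of_nat (qentry H u v) * x v)"
proof -
  have fin: "finite (verts H)"
    using H by (simp add: simple_graph_def)
  \<comment> \<open>The vertex \<open>u\<close> makes the vertex set nonempty, so the natural number
    \<open>card (verts H) - 1\<close> is not truncated.\<close>
  then have "1 \<le> card (verts H)"
    using u by (metis One_nat_def Suc_leI card_gt_0_iff empty_iff)
  then have n: "of_nat (card (verts H) - 1) = (of_nat (card (verts H)) - 1 :: 'k)"
    by (simp add: of_nat_diff)
  have Q: "of_nat (qentry (graph_complement H) u v) =
      ((if u = v then of_nat (card (verts H)) - 2 else 0) + 1 - of_nat (qentry H u v) :: 'k)"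
    if "v \<in> verts H" for v
    using arg_cong[OF qentry_complement[OF H u that], of "of_nat :: nat \<Rightarrow> 'k"] n
    by (auto simp: algebra_simps split: if_splits)
  have "(\<Sum>v\<in>verts H. of_nat (qentry (graph_complement H) u v) * x v) =
      (\<Sum>v\<in>verts H. (if u = v then (of_nat (card (verts H)) - 2) * x v else 0) + x v
        - of_nat (qentry H u v) * x v)"
    by (intro sum.cong refl) (auto simp: Q left_diff_distrib distrib_right)
  then show ?thesis
    using fin u by (simp add: sum.distrib sum_subtractf)
qed

section \<open>Signless Laplacian of the direct sum\<close>

lemma simple_graph_direct_sum:
  "simple_graph G \<Longrightarrow> simple_graph H \<Longrightarrow> simple_graph (graph_direct_sum G H)"
  by (auto simp: simple_graph_def graph_direct_sum_def card_image)

lemma qentry_direct_sum: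
  "qentry (graph_direct_sum G H) (Inl u) (Inl v) = qentry G u v"
  "qentry (graph_direct_sum G H) (Inr u') (Inr v') = qentry H u' v'"
  "qentry (graph_direct_sum G H) (Inl u) (Inr v') = 0"
  "qentry (graph_direct_sum G H) (Inr u') (Inl v) = 0"
proof -
  have "{e \<in> edges (graph_direct_sum G H). Inl u \<in> e \<and> Inl v \<in> e} =
      (`) Inl ` {e \<in> edges G. u \<in> e \<and> v \<in> e}"
    by (auto simp: graph_direct_sum_def)
  then show "qentry (graph_direct_sum G H) (Inl u) (Inl v) = qentry G u v"
    by (simp add: qentry_def card_image inj_on_def inj_image_eq_iff)
  have "{e \<in> edges (graph_direct_sum G H). Inr u' \<in> e \<and> Inr v' \<in> e} =
      (`) Inr ` {e \<in> edges H. u' \<in> e \<and> v' \<in> e}"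
    by (auto simp: graph_direct_sum_def)
  then show "qentry (graph_direct_sum G H) (Inr u') (Inr v') = qentry H u' v'"
    by (simp add: qentry_def card_image inj_on_def inj_image_eq_iff)
  have "{e \<in> edges (graph_direct_sum G H). Inl u \<in> e \<and> Inr v' \<in> e} = {}"
    by (auto simp: graph_direct_sum_def)
  then show "qentry (graph_direct_sum G H) (Inl u) (Inr v') = 0"
    unfolding qentry_def by (simp only: card.empty)
  have "{e \<in> edges (graph_direct_sum G H). Inr u' \<in> e \<and> Inl v \<in> e} = {}"
    by (auto simp: graph_direct_sum_def)
  then show "qentry (graph_direct_sum G H) (Inr u') (Inl v) = 0"
    unfolding qentry_def by (simp only: card.empty)
qed

section \<open>Signless Laplacian of the join\<close>

lemma simple_graph_join:
  "simple_graph G \<Longrightarrow> simple_graph H \<Longrightarrow> simple_graph (graph_join G H)"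
  using simple_graph_direct_sum[of G H]
  by (auto simp: simple_graph_def graph_join_def graph_direct_sum_def)

definition cross_edges :: "'a set \<Rightarrow> 'b set \<Rightarrow> ('a + 'b) set set" where
  "cross_edges V W = {{Inl u, Inr v} | u v. u \<in> V \<and> v \<in> W}"

lemma qentry_join:
  assumes G: "simple_graph G" and H: "simple_graph H"
  shows "qentry (graph_join G H) p q =
    qentry (graph_direct_sum G H) p q + card {e \<in> cross_edges (verts G) (verts H). p \<in> e \<and> q \<in> e}"
proof -
  let ?D = "{e \<in> edges (graph_direct_sum G H). p \<in> e \<and> q \<in> e}"
  let ?C = "{e \<in> cross_edges (verts G) (verts H). p \<in> e \<and> q \<in> e}"
  have "finite (edges (graph_join G H))"
    using G H simple_graph_join simple_graph_finite_edges by blast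
  then have "finite ?D" "finite ?C"
    by (auto simp: graph_join_def cross_edges_def)
  \<comment> \<open>A cross edge meets both parts, while an edge of the direct sum lies within one
    part.\<close>
  moreover have "?D \<inter> ?C = {}"
    by (auto simp: graph_direct_sum_def cross_edges_def)
  moreover have "{e \<in> edges (graph_join G H). p \<in> e \<and> q \<in> e} = ?D \<union> ?C"
    by (auto simp: graph_join_def cross_edges_def)
  ultimately show ?thesis
    unfolding qentry_def by (simp only: card_Un_disjoint)
qed

text \<open>This is the signless Laplacian of the complete bipartite graph: each diagonal entry is
  the size of the opposite part, and the off-diagonal blocks are all ones.\<close>

lemma card_cross_edges:
  shows "u \<in> V \<Longrightarrow> card {e \<in> cross_edges V W. Inl u \<in> e \<and> Inl v \<in> e}
        = (if u = v then card W else 0)"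
    and "u' \<in> W \<Longrightarrow> card {e \<in> cross_edges V W. Inr u' \<in> e \<and> Inr v' \<in> e}
        = (if u' = v' then card V else 0)"
    and "u \<in> V \<Longrightarrow> v' \<in> W \<Longrightarrow> card {e \<in> cross_edges V W. Inl u \<in> e \<and> Inr v' \<in> e} = 1"
    and "u' \<in> W \<Longrightarrow> v \<in> V \<Longrightarrow> card {e \<in> cross_edges V W. Inr u' \<in> e \<and> Inl v \<in> e} = 1"
proof -
  have "{e \<in> cross_edges V W. Inl u \<in> e \<and> Inl v \<in> e} =
      (if u = v then (\<lambda>w. {Inl u, Inr w}) ` W else {})" if "u \<in> V"
    using that by (auto simp: cross_edges_def)
  then show "card {e \<in> cross_edges V W. Inl u \<in> e \<and> Inl v \<in> e}
        = (if u = v then card W else 0)"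
    if "u \<in> V"
    using that by (simp add: card_image inj_on_def doubleton_eq_iff)
  have "{e \<in> cross_edges V W. Inr u' \<in> e \<and> Inr v' \<in> e} =
      (if u' = v' then (\<lambda>w. {Inl w, Inr u'}) ` V else {})" if "u' \<in> W"
    using that by (auto simp: cross_edges_def)
  then show "card {e \<in> cross_edges V W. Inr u' \<in> e \<and> Inr v' \<in> e}
        = (if u' = v' then card V else 0)"
    if "u' \<in> W"
    using that by (simp add: card_image inj_on_def doubleton_eq_iff)
  have "{e \<in> cross_edges V W. Inl u \<in> e \<and> Inr v' \<in> e} = {{Inl u, Inr v'}}"
    if "u \<in> V" "v' \<in> W"
    using that by (auto simp: cross_edges_def)
  then show "card {e \<in> cross_edges V W. Inl u \<in> e \<and> Inr v' \<in> e} = 1" if "u \<in> V" "v' \<in> W"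
    using that by simp
  have "{e \<in> cross_edges V W. Inr u' \<in> e \<and> Inl v \<in> e} = {{Inl v, Inr u'}}"
    if "u' \<in> W" "v \<in> V"
    using that by (auto simp: cross_edges_def)
  then show "card {e \<in> cross_edges V W. Inr u' \<in> e \<and> Inl v \<in> e} = 1" if "u' \<in> W" "v \<in> V"
    using that by simp
qed

lemma sum_qentry_join:
  fixes x :: "'a + 'b \<Rightarrow> 'k::comm_ring_1"
  assumes G: "simple_graph G" and H: "simple_graph H"
  shows "u \<in> verts G \<Longrightarrow>
      (\<Sum>p\<in>verts (graph_join G H). of_nat (qentry (graph_join G H) (Inl u) p) * x p) =
      (\<Sum>v\<in>verts G. of_nat (qentry G u v) * x (Inl v)) + of_nat (card (verts H)) * x (Inl u)
        + (\<Sum>v\<in>verts H. x (Inr v))"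
    and "w \<in> verts H \<Longrightarrow>
      (\<Sum>p\<in>verts (graph_join G H). of_nat (qentry (graph_join G H) (Inr w) p) * x p) =
      (\<Sum>v\<in>verts H. of_nat (qentry H w v) * x (Inr v)) + of_nat (card (verts G)) * x (Inr w)
        + (\<Sum>v\<in>verts G. x (Inl v))"
proof -
  have fin: "finite (verts G)" "finite (verts H)"
    using G H by (auto simp: simple_graph_def)
  have diag: "(\<Sum>v\<in>V. of_nat (g v + (if u = v then k else 0)) * y v) =
      (\<Sum>v\<in>V. of_nat (g v) * y v) + of_nat k * (y u :: 'k)"
    if "finite V" "u \<in> V" for V and g :: "'c \<Rightarrow> nat" and y k u
  proof -
    have "(\<Sum>v\<in>V. of_nat (g v + (if u = v then k else 0)) * y v) =
        (\<Sum>v\<in>V. of_nat (g v) * y v + (if u = v then of_nat k * y v else 0))"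
      by (intro sum.cong refl) (auto simp: algebra_simps)
    then show ?thesis
      using that by (simp add: sum.distrib)
  qed
  have split: "(\<Sum>p\<in>verts (graph_join G H). f p) =
      (\<Sum>v\<in>verts G. f (Inl v)) + (\<Sum>v\<in>verts H. f (Inr v))" for f :: "_ \<Rightarrow> 'k"
    using fin by (simp add: graph_join_def graph_direct_sum_def sum.Plus comp_def)
  show "(\<Sum>p\<in>verts (graph_join G H). of_nat (qentry (graph_join G H) (Inl u) p) * x p) =
      (\<Sum>v\<in>verts G. of_nat (qentry G u v) * x (Inl v)) + of_nat (card (verts H)) * x (Inl u)
        + (\<Sum>v\<in>verts H. x (Inr v))" if u: "u \<in> verts G"
    \<comment> \<open>\<open>of_nat_add\<close> is removed so that the summands keep the shape
      required by \<open>diag\<close>; \<open>sum.cong\<close> supplies the membership assumptions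
      of \<open>card_cross_edges\<close>.\<close>
    using u by (simp add: split qentry_join[OF G H] qentry_direct_sum card_cross_edges
        diag[OF fin(1) u] del: of_nat_add cong: sum.cong)
  show "(\<Sum>p\<in>verts (graph_join G H). of_nat (qentry (graph_join G H) (Inr w) p) * x p) =
      (\<Sum>v\<in>verts H. of_nat (qentry H w v) * x (Inr v)) + of_nat (card (verts G)) * x (Inr w)
        + (\<Sum>v\<in>verts G. x (Inl v))" if w: "w \<in> verts H"
    using w by (simp add: split qentry_join[OF G H] qentry_direct_sum card_cross_edges
        diag[OF fin(2) w] del: of_nat_add cong: sum.cong)
qed

section \<open>Generating functions of complement, direct sum and join\<close>

lemma Q_gf_complement:
  fixes H :: "'a graph"
  defines "t \<equiv> rat_fun_var" and "n \<equiv> of_nat (card (verts H))"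
  defines "W \<equiv> rat_fun_compose (Q_gf H) (t / ((n - 2) * t - 1))"
  assumes H: "simple_graph H"
  shows "Q_gf (graph_complement H) = - W / ((n - 2) * t - 1 + t * W)"
proof -
  define c where "c = (n - 2) * t - 1"
  define m where "m = (of_nat (card (verts H)) :: real)"
  have t: "value_at_0 t 0"
    unfolding t_def by (rule value_at_0_var)
  \<comment> \<open>The numeral 2 is written as \<open>1 + 1\<close> so that the rules for
    \<open>1\<close> and for sums apply.\<close>
  have "value_at_0 ((n - (1 + 1)) * t - 1) ((m - (1 + 1)) * 0 - 1)"
    unfolding n_def m_def by (intro value_at_0_diff value_at_0_mult value_at_0_add t) auto
  then have c: "value_at_0 c (-1)"
    by (simp add: c_def)
  then have c0: "c \<noteq> 0"
    by (rule value_at_0_nonzero) simp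
  have "value_at_0 (t / c) 0"
    using value_at_0_divide[OF t c] by simp
  then obtain x a where x: "Q_system H (t / c) 1 x" and sum: "(\<Sum>u\<in>verts H. x u) = W"
    and W: "value_at_0 W a"
    unfolding W_def c_def[symmetric] by (rule Q_system_compose[OF H])
  have "value_at_0 (c + t * W) (-1 + 0 * a)"
    by (intro value_at_0_add value_at_0_mult c t W)
  then have d0: "c + t * W \<noteq> 0"
    by (rule value_at_0_nonzero) simp
  \<comment> \<open>With \<open>Q'\<close> for the complement,
    \<open>I - t Q' = - c (I - (t / c) Q) - t J\<close>. This maps \<open>x\<close> to the constant
    vector \<open>- (c + t W)\<close>, so dividing by that constant gives right-hand side 1.\<close>
  define y where "y u = - x u / (c + t * W)" for u
  have "Q_system (graph_complement H) t 1 y"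
    unfolding Q_system_def
  proof
    fix u assume "u \<in> verts (graph_complement H)"
    then have u: "u \<in> verts H"
      by (simp add: graph_complement_def)
    let ?S = "\<Sum>v\<in>verts H. of_nat (qentry H u v) * x v"
    let ?T = "\<Sum>v\<in>verts H. of_nat (qentry (graph_complement H) u v) * x v"
    have "c * x u - t * ?S = c"
      using Q_systemD[OF x u] c0 by (simp add: field_simps)
    moreover have T: "?T = (n - 2) * x u + W - ?S"
      unfolding n_def sum[symmetric] by (rule sum_qentry_complement[OF H u])
    have "x u - t * ?T = - (c * x u - t * ?S) - t * W"
      unfolding T by (simp add: c_def algebra_simps)
    ultimately have "x u - t * ?T = - (c + t * W)"
      by simp
    moreover have "(\<Sum>v\<in>verts H. of_nat (qentry (graph_complement H) u v) * y v) =
        - ?T / (c + t * W)"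
      by (simp add: y_def sum_negf sum_divide_distrib)
    ultimately show "y u - t * (\<Sum>v\<in>verts (graph_complement H).
        of_nat (qentry (graph_complement H) u v) * y v) = 1"
      using d0 by (simp add: y_def graph_complement_def field_simps)
  qed
  then have "Q_gf (graph_complement H) = (\<Sum>u\<in>verts (graph_complement H). y u)"
    unfolding t_def by (rule Q_gf_eqI[OF simple_graph_complement[OF H]])
  also have "\<dots> = - W / (c + t * W)"
    by (simp add: y_def graph_complement_def sum_negf flip: sum_divide_distrib sum)
  finally show ?thesis
    by (simp add: c_def)
qed

text \<open>The signless Laplacian is block diagonal, so solutions for the two parts combine to one
  for the sum.\<close>

lemma Q_gf_direct_sum:
  fixes G :: "'a graph" and H :: "'b graph"
  assumes G: "simple_graph G" and H: "simple_graph H"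
  shows "Q_gf (graph_direct_sum G H) = Q_gf G + Q_gf H"
proof -
  have fin: "finite (verts G)" "finite (verts H)"
    using G H by (auto simp: simple_graph_def)
  obtain x :: "'a \<Rightarrow> real poly fract" where x: "Q_system G rat_fun_var 1 x"
    using Q_system_compose[OF G value_at_0_var] by metis
  obtain y :: "'b \<Rightarrow> real poly fract" where y: "Q_system H rat_fun_var 1 y"
    using Q_system_compose[OF H value_at_0_var] by metis
  have verts: "verts (graph_direct_sum G H) = verts G <+> verts H"
    by (simp add: graph_direct_sum_def)
  have split: "(\<Sum>p\<in>verts (graph_direct_sum G H). f p) =
      (\<Sum>v\<in>verts G. f (Inl v)) + (\<Sum>v\<in>verts H. f (Inr v))" for f :: "_ \<Rightarrow> real poly fract"
    using fin by (simp add: verts sum.Plus)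
  have "Q_system (graph_direct_sum G H) rat_fun_var 1 (case_sum x y)"
    using Q_systemD[OF x] Q_systemD[OF y]
    unfolding Q_system_def split by (auto simp: qentry_direct_sum verts)
  from Q_gf_eqI[OF simple_graph_direct_sum[OF G H] this] show ?thesis
    using Q_gf_eqI[OF G x] Q_gf_eqI[OF H y] by (simp add: split)
qed

text \<open>The scalar equation left by one block row of the join system, isolated because it is
  used for both parts with their roles exchanged.\<close>

lemma join_system_identity:
  fixes w1 w2 c d1 d2 m t :: "'k::field"
  assumes "d1 = c + t * w1" "m = 1 - t * (w1 / d1 + w2 / d2)" "d1 \<noteq> 0" "m \<noteq> 0"
  shows "c / (m * d1) - t * (w2 / (m * d2)) = 1"
proof -
  have "c = d1 - t * w1"
    using assms(1) by simp
  then have "c / d1 = 1 - t * (w1 / d1)"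
    using assms(3) by (simp add: diff_divide_distrib)
  then have "c / d1 - t * (w2 / d2) = m"
    by (simp add: assms(2) distrib_left)
  then have "(c / d1 - t * (w2 / d2)) / m = 1"
    using assms(4) by simp
  then show ?thesis
    by (simp add: diff_divide_distrib mult.commute)
qed

text \<open>A diagonal block of the join system is
  \<open>I - t (Q1 + n2 I) = c1 (I - (t / c1) Q1)\<close>, and symmetrically for the other part;
  this explains the shifted arguments.\<close>

lemma Q_gf_join:
  fixes G :: "'a graph" and H :: "'b graph"
  defines "t \<equiv> rat_fun_var"
  defines "c1 \<equiv> 1 - of_nat (card (verts H)) * t" and "c2 \<equiv> 1 - of_nat (card (verts G)) * t"
  defines "W1 \<equiv> rat_fun_compose (Q_gf G) (t / c1)" and "W2 \<equiv> rat_fun_compose (Q_gf H) (t / c2)"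
  defines "M \<equiv> W1 / (c1 + t * W1) + W2 / (c2 + t * W2)"
  assumes G: "simple_graph G" and H: "simple_graph H"
  shows "Q_gf (graph_join G H) = M / (1 - t * M)"
proof -
  have fin: "finite (verts G)" "finite (verts H)"
    using G H by (auto simp: simple_graph_def)
  have t: "value_at_0 t 0"
    unfolding t_def by (rule value_at_0_var)
  have c: "value_at_0 (1 - of_nat k * t) 1" for k
    using value_at_0_diff[OF value_at_0_1 value_at_0_mult[OF value_at_0_of_nat[of k] t]] by simp
  have c1: "value_at_0 c1 1" and c2: "value_at_0 c2 1"
    unfolding c1_def c2_def by (rule c)+
  have c0: "c1 \<noteq> 0" "c2 \<noteq> 0"
    using value_at_0_nonzero[OF c1] value_at_0_nonzero[OF c2] by auto
  have "value_at_0 (t / c1) 0" "value_at_0 (t / c2) 0"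
    using value_at_0_divide[OF t c1] value_at_0_divide[OF t c2] by auto
  then obtain x a y b where x: "Q_system G (t / c1) 1 x" "(\<Sum>u\<in>verts G. x u) = W1"
    and W1: "value_at_0 W1 a"
    and y: "Q_system H (t / c2) 1 y" "(\<Sum>u\<in>verts H. y u) = W2" and W2: "value_at_0 W2 b"
    unfolding W1_def W2_def
    using Q_system_compose[OF G, of "t / c1"] Q_system_compose[OF H, of "t / c2"] by metis
  define d1 where "d1 = c1 + t * W1"
  define d2 where "d2 = c2 + t * W2"
  have "value_at_0 d1 (1 + 0 * a)" "value_at_0 d2 (1 + 0 * b)"
    unfolding d1_def d2_def by (intro value_at_0_add value_at_0_mult c1 c2 t W1 W2)+
  then have d: "value_at_0 d1 1" "value_at_0 d2 1"
    by simp_all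
  then have d0: "d1 \<noteq> 0" "d2 \<noteq> 0"
    using value_at_0_nonzero by fastforce+
  define m where "m = 1 - t * M"
  \<comment> \<open>\<open>M\<close> is regular at the origin because \<open>d1\<close> and
    \<open>d2\<close> have value 1 there; hence \<open>1 - t M\<close> has value 1.\<close>
  have "value_at_0 m (1 - 0 * (a / 1 + b / 1))"
    unfolding m_def M_def d1_def[symmetric] d2_def[symmetric]
    by (intro value_at_0_diff value_at_0_add value_at_0_mult value_at_0_divide
        value_at_0_1 t d W1 W2) simp_all
  then have m0: "m \<noteq> 0"
    by (rule value_at_0_nonzero) simp
  have M: "M = W1 / d1 + W2 / d2"
    by (simp add: M_def d1_def d2_def)
  \<comment> \<open>For \<open>z\<close> equal to \<open>a1 x\<close> and \<open>a2 y\<close> on the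
    parts, the rows demand \<open>a1 c1 - t a2 W2 = 1\<close> and
    \<open>a2 c2 - t a1 W1 = 1\<close>. So \<open>a1 d1 = a2 d2 = k\<close> with
    \<open>k = 1 + t k M\<close>, that is, \<open>k = 1 / m\<close>.\<close>
  define z where "z = case_sum (\<lambda>u. x u / (m * d1)) (\<lambda>v. y v / (m * d2))"
  have "Q_system (graph_join G H) t 1 z"
    unfolding Q_system_def
  proof
    fix p assume "p \<in> verts (graph_join G H)"
    then consider u where "u \<in> verts G" "p = Inl u" | v where "v \<in> verts H" "p = Inr v"
      by (auto simp: graph_join_def graph_direct_sum_def)
    then show "z p - t * (\<Sum>q\<in>verts (graph_join G H). of_nat (qentry (graph_join G H) p q) * z q) = 1"
    proof cases
      case 1
      let ?S = "\<Sum>v\<in>verts G. of_nat (qentry G u v) * x v"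
      have "c1 * x u - t * ?S = c1"
        using Q_systemD[OF x(1) 1(1)] c0 by (simp add: field_simps)
      then have "(x u - t * (?S + of_nat (card (verts H)) * x u)) / (m * d1) = c1 / (m * d1)"
        by (simp add: c1_def algebra_simps)
      moreover have "c1 / (m * d1) - t * (W2 / (m * d2)) = 1"
        using d1_def m_def[unfolded M] d0(1) m0 by (rule join_system_identity)
      moreover have "(\<Sum>v\<in>verts G. of_nat (qentry G u v) * z (Inl v)) = ?S / (m * d1)"
        and "(\<Sum>v\<in>verts H. z (Inr v)) = W2 / (m * d2)"
        by (simp_all add: z_def sum_divide_distrib flip: y(2))
      moreover have "x u / (m * d1) - t * (?S / (m * d1) + of_nat (card (verts H)) * (x u / (m * d1))
          + W2 / (m * d2)) =
          (x u - t * (?S + of_nat (card (verts H)) * x u)) / (m * d1) - t * (W2 / (m * d2))"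
        by (simp add: diff_divide_distrib add_divide_distrib distrib_left)
      moreover have "z (Inl u) = x u / (m * d1)"
        by (simp add: z_def)
      ultimately show ?thesis
        unfolding 1(2) sum_qentry_join(1)[OF G H 1(1)] by (simp only:)
    next
      case 2
      let ?S = "\<Sum>w\<in>verts H. of_nat (qentry H v w) * y w"
      have "c2 * y v - t * ?S = c2"
        using Q_systemD[OF y(1) 2(1)] c0 by (simp add: field_simps)
      then have "(y v - t * (?S + of_nat (card (verts G)) * y v)) / (m * d2) = c2 / (m * d2)"
        by (simp add: c2_def algebra_simps)
      moreover have "c2 / (m * d2) - t * (W1 / (m * d1)) = 1"
        \<comment> \<open>Commuting the two summands of \<open>M\<close> yields the identity with
          the parts interchanged.\<close>
        using d2_def m_def[unfolded M add.commute[of "W1 / d1"]] d0(2) m0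
        by (rule join_system_identity)
      moreover have "(\<Sum>w\<in>verts H. of_nat (qentry H v w) * z (Inr w)) = ?S / (m * d2)"
        and "(\<Sum>u\<in>verts G. z (Inl u)) = W1 / (m * d1)"
        by (simp_all add: z_def sum_divide_distrib flip: x(2))
      moreover have "y v / (m * d2) - t * (?S / (m * d2) + of_nat (card (verts G)) * (y v / (m * d2))
          + W1 / (m * d1)) =
          (y v - t * (?S + of_nat (card (verts G)) * y v)) / (m * d2) - t * (W1 / (m * d1))"
        by (simp add: diff_divide_distrib add_divide_distrib distrib_left)
      moreover have "z (Inr v) = y v / (m * d2)"
        by (simp add: z_def)
      ultimately show ?thesis
        unfolding 2(2) sum_qentry_join(2)[OF G H 2(1)] by (simp only:)
    qed
  qed
  then have "Q_gf (graph_join G H) = (\<Sum>p\<in>verts (graph_join G H). z p)"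
    unfolding t_def by (rule Q_gf_eqI[OF simple_graph_join[OF G H]])
  also have "\<dots> = W1 / (m * d1) + W2 / (m * d2)"
    using fin x(2) y(2)
    by (simp add: graph_join_def graph_direct_sum_def sum.Plus z_def flip: sum_divide_distrib)
  also have "\<dots> = M / m"
    by (simp add: M add_divide_distrib mult.commute)
  finally show ?thesis
    by (simp add: m_def)
qed

theorem theorem2p14:
  fixes G :: "'a graph" and G1 :: "'b graph" and G2 :: "'c graph"
    and n n1 n2 :: nat
    and t :: "real poly fract"
  defines "t \<equiv> rat_fun_var"
  assumes "simple_graph G" and "connected_graph G" and "card (verts G) = n"
    and "simple_graph G1" and "connected_graph G1" and "card (verts G1) = n1"
    and "simple_graph G2" and "connected_graph G2" and "card (verts G2) = n2"
  shows
    "(let W = rat_fun_compose (Q_gf G) (t / ((of_nat n - 2) * t - 1))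
      in Q_gf (graph_complement G) = - W / ((of_nat n - 2) * t - 1 + t * W))
     \<and> Q_gf (graph_direct_sum G1 G2) = Q_gf G1 + Q_gf G2
     \<and> (let N = n1 + n2;
            W1 = rat_fun_compose (Q_gf G1) (t / ((of_nat n1 - of_nat N) * t + 1));
            W2 = rat_fun_compose (Q_gf G2) (t / ((of_nat n2 - of_nat N) * t + 1));
            M = W1 / ((of_nat n1 - of_nat N) * t + 1 + t * W1)
              + W2 / ((of_nat n2 - of_nat N) * t + 1 + t * W2)
        in Q_gf (graph_join G1 G2) = M / (1 - t * M))"
proof -
  have n: "n = card (verts G)" and n1: "n1 = card (verts G1)" and n2: "n2 = card (verts G2)"
    using assms by simp_all
  \<comment> \<open>\<open>N - n1\<close> and \<open>N - n2\<close> are the sizes of the opposite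
    parts, which is the form of the shift in \<open>Q_gf_join\<close>.\<close>
  have c: "(of_nat n1 - of_nat (n1 + n2)) * t + 1 = 1 - of_nat n2 * t"
    "(of_nat n2 - of_nat (n1 + n2)) * t + 1 = 1 - of_nat n1 * t"
    by (simp_all add: algebra_simps)
  show ?thesis
    unfolding Let_def c unfolding t_def n n1 n2
    by (intro conjI Q_gf_complement Q_gf_direct_sum Q_gf_join assms)
qed

end
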